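(* Let $I=[a,b]$ with $-\infty<a<b<\infty$, and let $\{\omega_{s,t}\}_{(s,t)\in I_+^2}$ be an evolution family on $I$. Then the following are equivalent: (i) the family $\{\omega_{s,t}\}_{(s,t)\in I_+^2}$ is jointly continuous; (vii) the family $\{\omega_{s,t}\}_{(s,t)\in I_+^2}$ is jointly continuous on the diagonal $D(I)=\{(t,t):t\in I\}$, i.e. the mapping $I_+^2\ni(s,t)\mapsto\omega_{s,t}\in\mathcal{A}$ is continuous at every point of $D(I)$; (viii) the family $\{\omega_{s,t}\}_{(s,t)\in I_+^2}$ is hyperbolically bounded, with $\lim_{s\le c\le t,\ t-s\searrow 0}\omega_{s,t}(0)=0$ and $\lim_{s\le c\le t,\ t-s\searrow 0}\omega_{s,t}'(0)=1$ for all $c\in[a,b]$.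
   Context: $\mathbb{D}=\{z\in\mathbb{C}:|z|<1\}$. $\mathcal{A}$ is the space of all analytic functions $f:\mathbb{D}\to\mathbb{C}$ with the topology of locally uniform convergence on $\mathbb{D}$, and $\mathfrak{B}=\{f\in\mathcal{A}: f(\mathbb{D})\subset\mathbb{D}\}$. For an interval $I$, $I_+^2=\{(s,t): s,t\in I,\ s\le t\}$. A prime denotes the derivative with respect to $z$. Evolution family: a family $\{\omega_{s,t}\}_{(s,t)\in I_+^2}$ in $\mathfrak{B}$ is an evolution family (on $I$) if (EF1) $\omega_{s,t}$ is non-constant for all $(s,t)\in I_+^2$; (EF2) $\omega_{t,t}=\mathrm{id}_{\mathbb{D}}$ for all $t\in I$; (EF3) $\omega_{u,t}\circ\omega_{s,u}=\omega_{s,t}$ for all $s,u,t\in I$ with $s\le u\le t$. Jointly continuous: the mapping $I_+^2\ni(s,t)\mapsto\omega_{s,t}\in\mathcal{A}$ is continuous. Hyperbolically bounded: $\sup_{(s,t)\in I_+^2}|\omega_{s,t}(0)|<1$. For fixed $c\in[a,b]$, the limit $\lim_{s\le c\le t,\ t-s\searrow 0}$ is taken over $s,t\in[a,b]$ with $s\le c\le t$ as $t-s$ decreases to $0$. *)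

theory Defs
  imports "HOL-Complex_Analysis.Complex_Analysis"
begin

abbreviation unit_disk :: "complex set" ("\<D>")
  where "\<D> \<equiv> ball 0 1"

(* A function on the disk is represented by any total function extending it; the values
   off the disk are never referred to, neither by the topology nor by (EF1)-(EF3). *)
definition analytic_disk :: "(complex \<Rightarrow> complex) set"
  where "analytic_disk = {f. f holomorphic_on \<D>}"

definition analytic_self_maps :: "(complex \<Rightarrow> complex) set"
  where "analytic_self_maps = {f \<in> analytic_disk. f ` \<D> \<subseteq> \<D>}"

(* The topology of locally uniform convergence on the disk: the sets
   {g. \<forall>z\<in>K. dist (g z) (f z) < \<epsilon>}, K compact, form a neighbourhood base at f. *)
definition loc_unif_open :: "(complex \<Rightarrow> complex) set \<Rightarrow> bool"
  where "loc_unif_open U \<longleftrightarrow> U \<subseteq> analytic_disk \<and>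
    (\<forall>f\<in>U. \<exists>K \<epsilon>. compact K \<and> K \<subseteq> \<D> \<and> \<epsilon> > 0 \<and>
       (\<forall>g\<in>analytic_disk. (\<forall>z\<in>K. dist (g z) (f z) < \<epsilon>) \<longrightarrow> g \<in> U))"

definition loc_unif_topology :: "(complex \<Rightarrow> complex) topology"
  where "loc_unif_topology = topology loc_unif_open"

lemma istopology_loc_unif_open: "istopology loc_unif_open"
  unfolding istopology_def
proof (intro conjI allI impI)
  fix S T assume S: "loc_unif_open S" and T: "loc_unif_open T"
  show "loc_unif_open (S \<inter> T)"
    unfolding loc_unif_open_def
  proof (intro conjI ballI)
    show "S \<inter> T \<subseteq> analytic_disk" using S by (auto simp: loc_unif_open_def)
    fix f assume f: "f \<in> S \<inter> T"
    obtain K1 e1 where 1: "compact K1" "K1 \<subseteq> \<D>" "e1 > 0"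
        "\<And>g. g \<in> analytic_disk \<Longrightarrow> (\<forall>z\<in>K1. dist (g z) (f z) < e1) \<Longrightarrow> g \<in> S"
      using S f unfolding loc_unif_open_def by (meson IntD1)
    obtain K2 e2 where 2: "compact K2" "K2 \<subseteq> \<D>" "e2 > 0"
        "\<And>g. g \<in> analytic_disk \<Longrightarrow> (\<forall>z\<in>K2. dist (g z) (f z) < e2) \<Longrightarrow> g \<in> T"
      using T f unfolding loc_unif_open_def by (meson IntD2)
    show "\<exists>K \<epsilon>. compact K \<and> K \<subseteq> \<D> \<and> \<epsilon> > 0 \<and>
       (\<forall>g\<in>analytic_disk. (\<forall>z\<in>K. dist (g z) (f z) < \<epsilon>) \<longrightarrow> g \<in> S \<inter> T)"
      using 1 2 by (intro exI[of _ "K1 \<union> K2"] exI[of _ "min e1 e2"]) (auto intro: compact_Un)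
  qed
next
  fix \<K> assume *: "\<forall>U\<in>\<K>. loc_unif_open U"
  show "loc_unif_open (\<Union>\<K>)"
    unfolding loc_unif_open_def
  proof (intro conjI ballI)
    show "\<Union>\<K> \<subseteq> analytic_disk" using * by (auto simp: loc_unif_open_def)
    fix f assume "f \<in> \<Union>\<K>"
    then obtain U where U: "U \<in> \<K>" "f \<in> U" by auto
    then obtain K e where "compact K" "K \<subseteq> \<D>" "e > 0"
        "\<And>g. g \<in> analytic_disk \<Longrightarrow> (\<forall>z\<in>K. dist (g z) (f z) < e) \<Longrightarrow> g \<in> U"
      using * unfolding loc_unif_open_def by meson
    with U show "\<exists>K \<epsilon>. compact K \<and> K \<subseteq> \<D> \<and> \<epsilon> > 0 \<and>
       (\<forall>g\<in>analytic_disk. (\<forall>z\<in>K. dist (g z) (f z) < \<epsilon>) \<longrightarrow> g \<in> \<Union>\<K>)"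
      by blast
  qed
qed

lemma openin_loc_unif_topology: "openin loc_unif_topology = loc_unif_open"
  unfolding loc_unif_topology_def using istopology_loc_unif_open by (rule topology_inverse')

lemma topspace_loc_unif_topology: "topspace loc_unif_topology = analytic_disk"
proof
  show "topspace loc_unif_topology \<subseteq> analytic_disk"
    by (auto simp: topspace_def openin_loc_unif_topology loc_unif_open_def)
  have "loc_unif_open analytic_disk"
    unfolding loc_unif_open_def by (auto intro!: exI[of _ "{}"] exI[of _ "1::real"])
  then show "analytic_disk \<subseteq> topspace loc_unif_topology"
    by (metis openin_loc_unif_topology openin_subset)
qed

lemma limitin_loc_unif_topology_iff:
  assumes F: "\<forall>\<^sub>F x in F. f x \<in> analytic_disk"
  shows "limitin loc_unif_topology f l F \<longleftrightarrow>
    l \<in> analytic_disk \<and> (\<forall>K. compact K \<longrightarrow> K \<subseteq> \<D> \<longrightarrow> uniform_limit K f l F)"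
proof (intro iffI conjI allI impI)
  assume lim: "limitin loc_unif_topology f l F"
  then show l: "l \<in> analytic_disk" by (simp add: limitin_def topspace_loc_unif_topology)
  fix K assume K: "compact K" "K \<subseteq> \<D>"
  show "uniform_limit K f l F"
    unfolding uniform_limit_iff
  proof (intro allI impI)
    fix e :: real assume e: "e > 0"
    define V where "V = {g \<in> analytic_disk. \<exists>d<e. \<forall>z\<in>K. dist (g z) (l z) \<le> d}"
    have "loc_unif_open V"
      unfolding loc_unif_open_def
    proof (intro conjI ballI)
      show "V \<subseteq> analytic_disk" by (auto simp: V_def)
      fix g assume "g \<in> V"
      then obtain d where d: "d < e" "\<And>z. z \<in> K \<Longrightarrow> dist (g z) (l z) \<le> d"
        by (auto simp: V_def)
      have "h \<in> V" if h: "h \<in> analytic_disk" "\<forall>z\<in>K. dist (h z) (g z) < (e - d) / 2" for h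
      proof -
        have "dist (h z) (l z) \<le> (e + d) / 2" if "z \<in> K" for z
        proof -
          have "dist (h z) (g z) < (e - d) / 2" "dist (g z) (l z) \<le> d"
            using h d that by auto
          then show ?thesis
            using dist_triangle[of "h z" "l z" "g z"] by (simp add: field_simps)
        qed
        moreover have "(e + d) / 2 < e" using d by simp
        ultimately show ?thesis using h unfolding V_def by blast
      qed
      then show "\<exists>K \<epsilon>. compact K \<and> K \<subseteq> \<D> \<and> \<epsilon> > 0 \<and>
         (\<forall>h\<in>analytic_disk. (\<forall>z\<in>K. dist (h z) (g z) < \<epsilon>) \<longrightarrow> h \<in> V)"
        using K d by (intro exI[of _ K] exI[of _ "(e - d) / 2"]) auto
    qed
    moreover have "l \<in> V" using l e by (auto simp: V_def intro!: exI[of _ 0])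
    ultimately have "\<forall>\<^sub>F x in F. f x \<in> V"
      using lim by (simp add: limitin_def openin_loc_unif_topology)
    then show "\<forall>\<^sub>F x in F. \<forall>z\<in>K. dist (f x z) (l z) < e"
      by eventually_elim (force simp: V_def)
  qed
next
  assume *: "l \<in> analytic_disk \<and> (\<forall>K. compact K \<longrightarrow> K \<subseteq> \<D> \<longrightarrow> uniform_limit K f l F)"
  show "limitin loc_unif_topology f l F"
    unfolding limitin_def openin_loc_unif_topology topspace_loc_unif_topology
  proof (intro conjI allI impI)
    show "l \<in> analytic_disk" using * by simp
    fix U assume U: "loc_unif_open U \<and> l \<in> U"
    then obtain K e where K: "compact K" "K \<subseteq> \<D>" "e > 0"
        "\<And>g. g \<in> analytic_disk \<Longrightarrow> (\<forall>z\<in>K. dist (g z) (l z) < e) \<Longrightarrow> g \<in> U"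
      unfolding loc_unif_open_def by meson
    then have "\<forall>\<^sub>F x in F. \<forall>z\<in>K. dist (f x z) (l z) < e"
      using * by (simp add: uniform_limit_iff)
    with F show "\<forall>\<^sub>F x in F. f x \<in> U"
      by eventually_elim (use K in auto)
  qed
qed

definition ordered_pairs :: "real set \<Rightarrow> (real \<times> real) set"
  where "ordered_pairs I = {(s, t). s \<in> I \<and> t \<in> I \<and> s \<le> t}"

(* A family indexed by ordered_pairs I; its members at other indices are irrelevant. *)
definition evolution_family :: "real set \<Rightarrow> (real \<Rightarrow> real \<Rightarrow> complex \<Rightarrow> complex) \<Rightarrow> bool"
  where "evolution_family I \<omega> \<longleftrightarrow>
    (\<forall>(s, t)\<in>ordered_pairs I. \<omega> s t \<in> analytic_self_maps) \<and>
    (\<forall>(s, t)\<in>ordered_pairs I. \<not> \<omega> s t constant_on \<D>) \<and>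
    (\<forall>t\<in>I. \<forall>z\<in>\<D>. \<omega> t t z = z) \<and>
    (\<forall>s\<in>I. \<forall>u\<in>I. \<forall>t\<in>I. s \<le> u \<longrightarrow> u \<le> t \<longrightarrow> (\<forall>z\<in>\<D>. (\<omega> u t \<circ> \<omega> s u) z = \<omega> s t z))"

definition jointly_continuous :: "real set \<Rightarrow> (real \<Rightarrow> real \<Rightarrow> complex \<Rightarrow> complex) \<Rightarrow> bool"
  where "jointly_continuous I \<omega> \<longleftrightarrow>
    continuous_map (top_of_set (ordered_pairs I)) loc_unif_topology (\<lambda>(s, t). \<omega> s t)"

definition jointly_continuous_on_diagonal ::
    "real set \<Rightarrow> (real \<Rightarrow> real \<Rightarrow> complex \<Rightarrow> complex) \<Rightarrow> bool"
  where "jointly_continuous_on_diagonal I \<omega> \<longleftrightarrow>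
    (\<forall>t\<in>I. topcontinuous_at (top_of_set (ordered_pairs I)) loc_unif_topology
              (\<lambda>(s, t). \<omega> s t) (t, t))"

definition hyperbolically_bounded ::
    "real set \<Rightarrow> (real \<Rightarrow> real \<Rightarrow> complex \<Rightarrow> complex) \<Rightarrow> bool"
  where "hyperbolically_bounded I \<omega> \<longleftrightarrow> (SUP (s, t)\<in>ordered_pairs I. cmod (\<omega> s t 0)) < 1"

(* The limit over s, t in I with s \<le> c \<le> t as t - s decreases to 0. *)
definition shrinking_to :: "real set \<Rightarrow> real \<Rightarrow> (real \<times> real) filter"
  where "shrinking_to I c =
    inf (filtercomap (\<lambda>(s, t). t - s) (at_right 0))
        (principal {(s, t). s \<in> I \<and> t \<in> I \<and> s \<le> c \<and> c \<le> t})"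

end

theory Submission
  imports Defs
begin

text \<open>
  Three facts about a single analytic self-map \<open>f\<close> of the disk carry the proof. First, \<open>f\<close> is
  Lipschitz on every smaller disk, with a constant that does not depend on \<open>f\<close>
  (\<open>self_map_lipschitz\<close>). Secondly, a bound \<open>\<bar>f 0\<bar> \<le> \<rho> < 1\<close> keeps the image of a smaller disk
  inside another one that is the same for all such \<open>f\<close> (\<open>self_maps_uniform_growth\<close>), so a hyperbolically
  bounded family has all its values at points of a compact set in one compact set. Thirdly, by
  normality and the equality case of the Schwarz lemma, \<open>f\<close> is close to the identity as soon as
  \<open>f 0\<close> is close to 0 and \<open>f' 0\<close> is close to 1 (\<open>self_maps_near_identity\<close>).

  In an evolution family \<open>\<omega> s t\<close> is the composition of \<open>\<omega> s u\<close> with \<open>\<omega> u t\<close> applied last. If one of the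
  two factors is close to the identity, then \<open>\<omega> s t\<close> is close to the other one: for the outer factor
  this needs that the values of the inner one stay in a compact set, for the inner factor it is the
  Lipschitz bound.

  Continuity at an arbitrary pair follows from continuity on the diagonal by moving first the final
  and then the initial time (\<open>diagonal_imp_everywhere\<close>). Likewise, the limit conditions make
  \<open>\<omega> s t\<close> close to the identity when \<open>s \<le> c \<le> t\<close>, and a short interval on one side of \<open>c\<close> is reduced
  to intervals with \<open>c\<close> as an end point (\<open>limits_imp_diagonal\<close>). Conversely, continuity on the diagonal
  gives the limits by a Cauchy estimate for the derivative, and it gives hyperbolic boundedness
  because a uniform bound over a short time survives finitely many compositions
  (\<open>diagonal_imp_hyperbolically_bounded\<close>).
\<close>

section \<open>Analytic self-maps of the disk\<close>

lemma compact_subset_unit_disk_in_cball: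
  assumes "compact K" "K \<subseteq> \<D>"
  obtains r where "0 \<le> r" "r < 1" "K \<subseteq> cball 0 r"
proof (cases "K = {}")
  case True
  then show ?thesis using that[of 0] by auto
next
  case False
  obtain w where "w \<in> K" "\<And>z. z \<in> K \<Longrightarrow> cmod z \<le> cmod w"
    using continuous_attains_sup[OF assms(1) False, of cmod] by (auto intro: continuous_intros)
  with assms(2) show ?thesis by (intro that[of "cmod w"]) auto
qed

lemma self_map_norm_less:
  assumes "f \<in> analytic_self_maps" "cmod z < 1"
  shows "cmod (f z) < 1"
  using assms by (force simp: analytic_self_maps_def)

lemma self_map_holomorphic: "f \<in> analytic_self_maps \<Longrightarrow> f holomorphic_on \<D>"
  by (simp add: analytic_self_maps_def analytic_disk_def)

text \<open>
  The closed disk of radius \<open>1 - R\<close> about a point of modulus at most \<open>R\<close> may touch the unit circle,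
  so the Cauchy estimate for the derivative is applied with radius \<open>q * (1 - R)\<close> for every \<open>q < 1\<close>.
\<close>

lemma self_map_lipschitz:
  assumes f: "f \<in> analytic_self_maps" and R: "R < 1" and xy: "cmod x \<le> R" "cmod y \<le> R"
  shows "cmod (f x - f y) \<le> cmod (x - y) / (1 - R)"
proof -
  note hol = self_map_holomorphic[OF f]
  have bound: "cmod (deriv f z) \<le> 1 / (1 - R)" if "z \<in> cball 0 R" for z
  proof (rule field_le_mult_one_interval)
    fix q :: real assume q: "0 < q" "q < 1"
    have sub: "cball z (q * (1 - R)) \<subseteq> \<D>"
    proof
      fix w assume "w \<in> cball z (q * (1 - R))"
      then have "cmod (w - z) \<le> q * (1 - R)" by (simp add: dist_norm norm_minus_commute)
      also have "\<dots> < 1 - R" using q R by simp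
      finally show "w \<in> \<D>" using that norm_triangle_ineq2[of w z] by auto
    qed
    have "cmod ((deriv ^^ 1) f z) \<le> fact 1 * 1 / (q * (1 - R)) ^ 1"
    proof (rule Cauchy_inequality)
      show "f holomorphic_on ball z (q * (1 - R))"
        using sub ball_subset_cball by (blast intro: holomorphic_on_subset[OF hol])
      show "continuous_on (cball z (q * (1 - R))) f"
        using sub by (blast intro: holomorphic_on_imp_continuous_on holomorphic_on_subset[OF hol])
      show "0 < q * (1 - R)" using q R by simp
      show "cmod (f w) \<le> 1" if "cmod (z - w) = q * (1 - R)" for w
        using sub that self_map_norm_less[OF f, of w] by (auto simp: subset_iff dist_norm less_imp_le)
    qed
    then show "q * cmod (deriv f z) \<le> 1 / (1 - R)"
      using q R by (simp add: field_simps)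
  qed
  have "cmod (f x - f y) \<le> 1 / (1 - R) * cmod (x - y)"
  proof (rule field_differentiable_bound[OF convex_cball _ bound])
    show "(f has_field_derivative deriv f z) (at z within cball 0 R)" if "z \<in> cball 0 R" for z
      using that R by (intro holomorphic_derivI[OF hol]) auto
  qed (use xy in auto)
  then show ?thesis by simp
qed

text \<open>
  This is the Schwarz lemma for the composition of \<open>f\<close> with the disk automorphism that maps \<open>f 0\<close> to 0,
  with the denominator cleared.
\<close>

lemma Schwarz_Pick_origin:
  assumes f: "f \<in> analytic_self_maps" and z: "cmod z < 1"
  shows "cmod (f z - f 0) \<le> cmod z * cmod (1 - cnj (f 0) * f z)"
proof -
  define M where "M = Moebius_function 0 (f 0)"
  have f0: "cmod (f 0) < 1" using self_map_norm_less[OF f, of 0] by simp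
  have ne: "1 - cnj (f 0) * f z \<noteq> 0"
  proof
    assume "1 - cnj (f 0) * f z = 0"
    then have "cmod (f 0) * cmod (f z) = 1"
      by (metis complex_mod_cnj norm_mult norm_one right_minus_eq)
    then show False
      using mult_strict_mono[OF f0 self_map_norm_less[OF f z]] by simp
  qed
  have "cmod ((M \<circ> f) z) \<le> cmod z"
  proof (rule Schwarz_Lemma(1)[OF _ _ _ z])
    show "(M \<circ> f) holomorphic_on \<D>"
      unfolding M_def using f
      by (intro holomorphic_on_compose_gen[OF self_map_holomorphic[OF f]
            Moebius_function_holomorphic[OF f0]]) (simp add: analytic_self_maps_def)
    show "(M \<circ> f) 0 = 0" by (simp add: M_def Moebius_function_eq_zero)
    show "cmod ((M \<circ> f) w) < 1" if "cmod w < 1" for w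
      using that by (simp add: M_def Moebius_function_norm_lt_1 f0 self_map_norm_less[OF f])
  qed
  then show ?thesis
    using ne by (simp add: M_def Moebius_function_simple norm_divide divide_simps)
qed

lemma norm_Moebius_identity:
  fixes a w :: complex
  shows "(cmod (1 - cnj a * w))\<^sup>2 - (cmod (w - a))\<^sup>2 = (1 - (cmod a)\<^sup>2) * (1 - (cmod w)\<^sup>2)"
  by (simp add: cmod_power2) (simp add: algebra_simps power2_eq_square)

text \<open>
  Let \<open>A = \<bar>1 - cnj (f 0) * f z\<bar>\<close>. Inserting the Schwarz--Pick bound into the Moebius identity gives
  \<open>(1 - r\<^sup>2) A\<^sup>2 \<le> (1 - \<bar>f 0\<bar>\<^sup>2) (1 - \<bar>f z\<bar>\<^sup>2)\<close>, and \<open>A \<ge> 1 - \<rho>\<close> bounds \<open>\<bar>f z\<bar>\<close> away from 1. The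
  maximum with \<open>r\<close> makes the new disk contain the old one, so that later estimates can be carried out
  on one disk.
\<close>

lemma self_maps_uniform_growth:
  assumes "0 \<le> r" "r < 1" "\<rho> < 1"
  obtains R where "r \<le> R" "R < 1"
    "\<And>f z. f \<in> analytic_self_maps \<Longrightarrow> cmod (f 0) \<le> \<rho> \<Longrightarrow> cmod z \<le> r \<Longrightarrow> cmod (f z) \<le> R"
proof
  let ?m = "(1 - r\<^sup>2) * (1 - \<rho>)\<^sup>2"
  let ?R = "max r (sqrt (1 - ?m))"
  have r2: "r\<^sup>2 < 1" using assms by (simp add: power_less_one_iff)
  have "0 < ?m" using r2 assms by simp
  then show "?R < 1" using assms by simp
  show "r \<le> ?R" by simp
  fix f z assume f: "f \<in> analytic_self_maps" and f0: "cmod (f 0) \<le> \<rho>" and z: "cmod z \<le> r"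
  define A where "A = cmod (1 - cnj (f 0) * f z)"
  have z1: "cmod z < 1" using z assms by simp
  have fz: "cmod (f z) < 1" by (rule self_map_norm_less[OF f z1])
  have "cmod (f z - f 0) \<le> cmod z * A"
    unfolding A_def by (rule Schwarz_Pick_origin[OF f z1])
  also have "\<dots> \<le> r * A" using z by (simp add: A_def mult_right_mono)
  finally have "(cmod (f z - f 0))\<^sup>2 \<le> r\<^sup>2 * A\<^sup>2"
    by (metis norm_ge_zero power_mono power_mult_distrib)
  then have "(1 - r\<^sup>2) * A\<^sup>2 \<le> (1 - (cmod (f 0))\<^sup>2) * (1 - (cmod (f z))\<^sup>2)"
    unfolding norm_Moebius_identity[symmetric] A_def[symmetric] by (simp add: algebra_simps)
  also have "\<dots> \<le> 1 * (1 - (cmod (f z))\<^sup>2)"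
    using fz by (intro mult_right_mono) (auto simp: power_le_one)
  finally have "(1 - r\<^sup>2) * A\<^sup>2 \<le> 1 - (cmod (f z))\<^sup>2" by simp
  moreover have "1 - \<rho> \<le> A"
  proof -
    have "cmod (cnj (f 0) * f z) \<le> \<rho> * 1"
      unfolding norm_mult complex_mod_cnj
      using f0 fz order_trans[OF norm_ge_zero f0] by (intro mult_mono) auto
    then show ?thesis
      unfolding A_def using norm_triangle_ineq2[of 1 "cnj (f 0) * f z"] by simp
  qed
  then have "?m \<le> (1 - r\<^sup>2) * A\<^sup>2"
    using assms r2 by (intro mult_left_mono power_mono) auto
  ultimately have "(cmod (f z))\<^sup>2 \<le> 1 - ?m" by simp
  then have "cmod (f z) \<le> sqrt (1 - ?m)" by (rule real_le_rsqrt)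
  then show "cmod (f z) \<le> ?R" by simp
qed

text \<open>
  The bound on \<open>g\<close> is not strict because \<open>g\<close> arises as a limit of self-maps. The maximum modulus
  principle makes it strict, since a constant has derivative 0. Then the equality case of the Schwarz
  lemma applies.
\<close>

lemma Schwarz_identity:
  assumes hol: "g holomorphic_on \<D>" and bd: "\<And>z. cmod z < 1 \<Longrightarrow> cmod (g z) \<le> 1"
    and g0: "g 0 = 0" and g1: "deriv g 0 = 1" and z: "cmod z < 1"
  shows "g z = z"
proof -
  have strict: "cmod (g w) < 1" if w: "cmod w < 1" for w
  proof (rule ccontr)
    assume "\<not> cmod (g w) < 1"
    then have "cmod (g w) = 1" using bd[OF w] by simp
    then have "g constant_on \<D>"
      using w bd
      by (intro maximum_modulus_principle[OF hol open_ball _ open_ball subset_refl, of w]) auto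
    then have "eventually (\<lambda>x. g x = 0) (nhds 0)"
      using eventually_nhds_in_open[of \<D> 0] g0
      by (auto simp: constant_on_def elim: eventually_mono)
    then have "deriv g 0 = deriv (\<lambda>_. 0) 0" by (intro deriv_cong_ev) auto
    then show False using g1 by simp
  qed
  obtain \<alpha> where \<alpha>: "\<And>w. cmod w < 1 \<Longrightarrow> g w = \<alpha> * w"
    using Schwarz_Lemma(3)[OF hol g0 strict z] g1 by auto
  then have "eventually (\<lambda>w. g w = \<alpha> * w) (nhds 0)"
    using eventually_nhds_in_open[of \<D> 0] by (auto elim: eventually_mono)
  then have "deriv g 0 = deriv (\<lambda>w. \<alpha> * w) 0" by (intro deriv_cong_ev) auto
  then show ?thesis using g1 \<alpha>[OF z] by simp
qed

text \<open>
  Otherwise there are self-maps \<open>F n\<close> with \<open>F n 0\<close> tending to 0 and \<open>deriv (F n) 0\<close> tending to 1,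
  each of which moves some point of the disk of radius \<open>r\<close> by at least \<open>e\<close>. By Montel's theorem a
  subsequence converges locally uniformly. Its limit fixes 0 with derivative 1 and hence is the
  identity, a contradiction.
\<close>

lemma self_maps_near_identity:
  assumes "r < 1" "0 < e"
  obtains \<delta> where "0 < \<delta>"
    "\<And>f z. f \<in> analytic_self_maps \<Longrightarrow> cmod (f 0) < \<delta> \<Longrightarrow> cmod (deriv f 0 - 1) < \<delta> \<Longrightarrow>
       cmod z \<le> r \<Longrightarrow> cmod (f z - z) < e"
proof (rule ccontr)
  assume "\<not> thesis"
  then have "\<exists>f. f \<in> analytic_self_maps \<and> cmod (f 0) < inverse (Suc n) \<and>
      cmod (deriv f 0 - 1) < inverse (Suc n) \<and> (\<exists>z. cmod z \<le> r \<and> \<not> cmod (f z - z) < e)" for n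
    using that[of "inverse (Suc n)"] by (metis inverse_positive_iff_positive of_nat_0_less_iff zero_less_Suc)
  then obtain F where F: "\<And>n. F n \<in> analytic_self_maps"
      "\<And>n. cmod (F n 0) < inverse (Suc n)" "\<And>n. cmod (deriv (F n) 0 - 1) < inverse (Suc n)"
      "\<And>n. \<exists>z. cmod z \<le> r \<and> \<not> cmod (F n z - z) < e"
    by metis
  obtain g k where g: "g holomorphic_on \<D>" "strict_mono (k :: nat \<Rightarrow> nat)"
      "\<And>x. x \<in> \<D> \<Longrightarrow> (\<lambda>n. F (k n) x) \<longlonglongrightarrow> g x"
      "\<And>K. compact K \<Longrightarrow> K \<subseteq> \<D> \<Longrightarrow> uniform_limit K (F \<circ> k) g sequentially"
  proof (rule Montel[of \<D> analytic_self_maps F])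
    show "\<exists>B. \<forall>h\<in>analytic_self_maps. \<forall>z\<in>K. cmod (h z) \<le> B" if "K \<subseteq> \<D>" for K
      using that self_map_norm_less by (intro exI[of _ 1]) (force simp: subset_iff less_imp_le)
  qed (use F(1) self_map_holomorphic in auto)
  have sub: "(\<lambda>n. h (k n)) \<longlonglongrightarrow> l" if "h \<longlonglongrightarrow> l" for h :: "nat \<Rightarrow> complex" and l
    using LIMSEQ_subseq_LIMSEQ[OF that g(2)] by (simp add: o_def)
  have null: "(\<lambda>n. F n 0) \<longlonglongrightarrow> 0" "(\<lambda>n. deriv (F n) 0 - 1) \<longlonglongrightarrow> 0"
    using F(2,3) by (auto intro!: Lim_null_comparison[OF _ LIMSEQ_inverse_real_of_nat] always_eventually less_imp_le)
  have "g 0 = 0"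
    using LIMSEQ_unique[OF g(3) sub[OF null(1)]] by simp
  moreover have "deriv g 0 = 1"
  proof (rule LIMSEQ_unique)
    show "(\<lambda>n. deriv ((F \<circ> k) n) 0) \<longlonglongrightarrow> deriv g 0"
    proof (rule deriv_complex_uniform_limit)
      show "uniform_limit (ball 0 (1/2)) (F \<circ> k) g sequentially"
        by (rule uniform_limit_on_subset[OF g(4)[OF compact_cball] ball_subset_cball]) auto
      show "\<forall>\<^sub>F n in sequentially. (F \<circ> k) n holomorphic_on ball 0 (1/2)"
        using F(1) by (auto intro!: always_eventually holomorphic_on_subset[OF self_map_holomorphic])
    qed auto
    show "(\<lambda>n. deriv ((F \<circ> k) n) 0) \<longlonglongrightarrow> 1"
      using sub[OF null(2)] by (simp add: o_def LIM_zero_iff)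
  qed
  moreover have "cmod (g z) \<le> 1" if "cmod z < 1" for z
    using g(3)[of z] self_map_norm_less[OF F(1) that] that
    by (intro LIMSEQ_le_const2[OF tendsto_norm]) (auto simp: less_imp_le)
  ultimately have id: "g z = z" if "cmod z < 1" for z
    using Schwarz_identity[OF g(1)] that by blast
  have "uniform_limit (cball 0 r) (F \<circ> k) g sequentially"
    using assms by (intro g(4)) auto
  then have "\<forall>\<^sub>F n in sequentially. \<forall>z\<in>cball 0 r. dist ((F \<circ> k) n z) (g z) < e"
    using assms(2) by (simp add: uniform_limit_iff)
  then obtain n where n: "\<forall>z\<in>cball 0 r. dist (F (k n) z) (g z) < e"
    by (auto simp: eventually_sequentially)
  then have "cmod (F (k n) z - z) < e" if "cmod z \<le> r" for z
    using that bspec[OF n, of z] id[of z] assms(1) by (simp add: dist_norm)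
  then show False using F(4)[of "k n"] by blast
qed

lemma deriv_near_one:
  assumes hol: "f holomorphic_on \<D>" and close: "\<And>z. cmod z \<le> 1/2 \<Longrightarrow> cmod (f z - z) \<le> e"
  shows "cmod (deriv f 0 - 1) \<le> 2 * e"
proof -
  have hol': "(\<lambda>z. f z - z) holomorphic_on \<D>" by (intro holomorphic_intros hol)
  have "cmod ((deriv ^^ 1) (\<lambda>z. f z - z) 0) \<le> fact 1 * e / (1/2) ^ 1"
  proof (rule Cauchy_inequality)
    show "continuous_on (cball 0 (1/2)) (\<lambda>z. f z - z)"
      by (rule holomorphic_on_imp_continuous_on[OF holomorphic_on_subset[OF hol']]) auto
  qed (use close in \<open>auto intro!: holomorphic_on_subset[OF hol']\<close>)
  moreover have "deriv (\<lambda>z. f z - z) 0 = deriv f 0 - 1"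
    using holomorphic_on_imp_differentiable_at[OF hol open_ball, of 0] by (subst deriv_diff) auto
  ultimately show ?thesis by simp
qed

section \<open>The topological notions in terms of inequalities\<close>

text \<open>
  The closed disks of radius \<open>r < 1\<close> exhaust the unit disk, so they replace the compact sets in the
  definition of locally uniform convergence.
\<close>

definition loc_unif_continuous_at ::
    "real set \<Rightarrow> (real \<Rightarrow> real \<Rightarrow> complex \<Rightarrow> complex) \<Rightarrow> real \<Rightarrow> real \<Rightarrow> bool"
  where "loc_unif_continuous_at I \<omega> s\<^sub>0 t\<^sub>0 \<longleftrightarrow>
    (\<forall>r<1. \<forall>e>0. \<exists>d>0. \<forall>s\<in>I. \<forall>t\<in>I. s \<le> t \<longrightarrow> \<bar>s - s\<^sub>0\<bar> < d \<longrightarrow> \<bar>t - t\<^sub>0\<bar> < d \<longrightarrow>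
      (\<forall>z. cmod z \<le> r \<longrightarrow> cmod (\<omega> s t z - \<omega> s\<^sub>0 t\<^sub>0 z) < e))"

lemma eventually_shrinking_to:
  "eventually P (shrinking_to I c) \<longleftrightarrow>
    (\<exists>d>0. \<forall>s\<in>I. \<forall>t\<in>I. s \<le> c \<longrightarrow> c \<le> t \<longrightarrow> s < t \<longrightarrow> t - s < d \<longrightarrow> P (s, t))"
  (is "?lhs \<longleftrightarrow> ?rhs")
proof
  assume ?lhs
  then obtain Q d where "d > 0" "\<And>x. 0 < x \<Longrightarrow> x < d \<Longrightarrow> Q x"
      "\<And>s t. Q (t - s) \<Longrightarrow> s \<in> I \<Longrightarrow> t \<in> I \<Longrightarrow> s \<le> c \<Longrightarrow> c \<le> t \<Longrightarrow> P (s, t)"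
    unfolding shrinking_to_def eventually_inf_principal eventually_filtercomap
      eventually_at_right_field by fastforce
  then show ?rhs by (intro exI[of _ d]) auto
next
  assume ?rhs
  then obtain d where "d > 0"
      "\<And>s t. s \<in> I \<Longrightarrow> t \<in> I \<Longrightarrow> s \<le> c \<Longrightarrow> c \<le> t \<Longrightarrow> s < t \<Longrightarrow> t - s < d \<Longrightarrow> P (s, t)"
    by blast
  then show ?lhs
    unfolding shrinking_to_def eventually_inf_principal eventually_filtercomap
      eventually_at_right_field
    by (intro exI[of _ "\<lambda>x. 0 < x \<and> x < d"]) auto
qed

lemma atin_within_euclidean: "atin_within euclidean x S = at x within S"
  by (auto simp: filter_eq_iff eventually_atin_within eventually_at_topological)

section \<open>Evolution families\<close>

locale evolution =
  fixes I :: "real set" and \<omega> :: "real \<Rightarrow> real \<Rightarrow> complex \<Rightarrow> complex"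
  assumes evolution_family: "evolution_family I \<omega>"
begin

lemma self_map: "s \<in> I \<Longrightarrow> t \<in> I \<Longrightarrow> s \<le> t \<Longrightarrow> \<omega> s t \<in> analytic_self_maps"
  using evolution_family by (auto simp: evolution_family_def ordered_pairs_def)

lemma ident: "t \<in> I \<Longrightarrow> cmod z < 1 \<Longrightarrow> \<omega> t t z = z"
  using evolution_family by (auto simp: evolution_family_def)

lemma cocycle:
  "s \<in> I \<Longrightarrow> u \<in> I \<Longrightarrow> t \<in> I \<Longrightarrow> s \<le> u \<Longrightarrow> u \<le> t \<Longrightarrow> cmod z < 1 \<Longrightarrow> \<omega> u t (\<omega> s u z) = \<omega> s t z"
  using evolution_family by (auto simp: evolution_family_def)

lemma continuous_at_diagonal_near_identity:
  assumes "c \<in> I" "loc_unif_continuous_at I \<omega> c c" "r < 1" "0 < e"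
  obtains d where "d > 0" "\<And>s t z. s \<in> I \<Longrightarrow> t \<in> I \<Longrightarrow> s \<le> t \<Longrightarrow> \<bar>s - c\<bar> < d \<Longrightarrow>
    \<bar>t - c\<bar> < d \<Longrightarrow> cmod z \<le> r \<Longrightarrow> cmod (\<omega> s t z - z) < e"
proof -
  from assms(2)[unfolded loc_unif_continuous_at_def, rule_format, OF assms(3,4)]
  obtain d where "d > 0" "\<And>s t z. s \<in> I \<Longrightarrow> t \<in> I \<Longrightarrow> s \<le> t \<Longrightarrow> \<bar>s - c\<bar> < d \<Longrightarrow>
      \<bar>t - c\<bar> < d \<Longrightarrow> cmod z \<le> r \<Longrightarrow> cmod (\<omega> s t z - \<omega> c c z) < e"
    by blast
  then show thesis using ident[OF assms(1)] assms(3) by (intro that[of d]) auto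
qed

text \<open>
  Locally uniform convergence along the punctured neighbourhoods of the pair, tested on closed disks,
  is turned into a statement about the two times separately.
\<close>

lemma topcontinuous_at_iff:
  assumes "s\<^sub>0 \<in> I" "t\<^sub>0 \<in> I" "s\<^sub>0 \<le> t\<^sub>0"
  shows "topcontinuous_at (top_of_set (ordered_pairs I)) loc_unif_topology (\<lambda>(s, t). \<omega> s t) (s\<^sub>0, t\<^sub>0)
    \<longleftrightarrow> loc_unif_continuous_at I \<omega> s\<^sub>0 t\<^sub>0"
proof -
  let ?F = "at (s\<^sub>0, t\<^sub>0) within ordered_pairs I"
  let ?w = "\<lambda>(s, t). \<omega> s t"
  have mem: "(s\<^sub>0, t\<^sub>0) \<in> ordered_pairs I" using assms by (simp add: ordered_pairs_def)
  have an: "?w x \<in> analytic_disk" if "x \<in> ordered_pairs I" for x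
    using that self_map by (auto simp: ordered_pairs_def analytic_self_maps_def)
  have "topcontinuous_at (top_of_set (ordered_pairs I)) loc_unif_topology ?w (s\<^sub>0, t\<^sub>0) \<longleftrightarrow>
      limitin loc_unif_topology ?w (\<omega> s\<^sub>0 t\<^sub>0) ?F"
    using mem an by (simp add: topcontinuous_at_atin atin_subtopology_within
        atin_within_euclidean       topspace_loc_unif_topology Pi_iff del: split_paired_All)
  also have "\<dots> \<longleftrightarrow> (\<forall>K. compact K \<longrightarrow> K \<subseteq> \<D> \<longrightarrow> uniform_limit K ?w (\<omega> s\<^sub>0 t\<^sub>0) ?F)"
    using an[OF mem] an
    by (subst limitin_loc_unif_topology_iff) (auto simp: eventually_at_filter intro!: always_eventually)
  also have "\<dots> \<longleftrightarrow> (\<forall>r<1. uniform_limit (cball 0 r) ?w (\<omega> s\<^sub>0 t\<^sub>0) ?F)" (is "?l \<longleftrightarrow> ?r")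
  proof
    show ?r if l: ?l by (intro allI impI l[rule_format]) auto
    assume r: ?r
    show ?l
    proof (intro allI impI)
      fix K :: "complex set" assume "compact K" "K \<subseteq> \<D>"
      then obtain q where "q < 1" "K \<subseteq> cball 0 q" by (rule compact_subset_unit_disk_in_cball)
      with r show "uniform_limit K ?w (\<omega> s\<^sub>0 t\<^sub>0) ?F" by (blast intro: uniform_limit_on_subset)
    qed
  qed
  also have "\<dots> \<longleftrightarrow> loc_unif_continuous_at I \<omega> s\<^sub>0 t\<^sub>0" (is "?l \<longleftrightarrow> ?r")
  proof
    assume l: ?l
    show ?r
      unfolding loc_unif_continuous_at_def
    proof (intro allI impI)
      fix r e :: real assume re: "r < 1" "0 < e"
      then obtain d where d: "d > 0" and *:
          "\<And>x. x \<in> ordered_pairs I \<Longrightarrow> x \<noteq> (s\<^sub>0, t\<^sub>0) \<Longrightarrow> dist x (s\<^sub>0, t\<^sub>0) < d \<Longrightarrow>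
             \<forall>z\<in>cball 0 r. dist (?w x z) (\<omega> s\<^sub>0 t\<^sub>0 z) < e"
        using l unfolding uniform_limit_iff eventually_at by metis
      have "cmod (\<omega> s t z - \<omega> s\<^sub>0 t\<^sub>0 z) < e"
        if "s \<in> I" "t \<in> I" "s \<le> t" "\<bar>s - s\<^sub>0\<bar> < d/2" "\<bar>t - t\<^sub>0\<bar> < d/2" "cmod z \<le> r" for s t z
      proof (cases "(s, t) = (s\<^sub>0, t\<^sub>0)")
        case True then show ?thesis using re by simp
      next
        case False
        have "dist (s, t) (s\<^sub>0, t\<^sub>0) \<le> \<bar>s - s\<^sub>0\<bar> + \<bar>t - t\<^sub>0\<bar>"
          unfolding dist_Pair_Pair dist_real_def by (rule sqrt_sum_squares_le_sum_abs[THEN order_trans]) simp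
        then show ?thesis using *[of "(s, t)"] that False by (auto simp: ordered_pairs_def dist_norm)
      qed
      then show "\<exists>d>0. \<forall>s\<in>I. \<forall>t\<in>I. s \<le> t \<longrightarrow> \<bar>s - s\<^sub>0\<bar> < d \<longrightarrow> \<bar>t - t\<^sub>0\<bar> < d \<longrightarrow>
          (\<forall>z. cmod z \<le> r \<longrightarrow> cmod (\<omega> s t z - \<omega> s\<^sub>0 t\<^sub>0 z) < e)"
        using d by (intro exI[of _ "d/2"]) auto
    qed
  next
    assume r: ?r
    show ?l
      unfolding uniform_limit_iff eventually_at
    proof (intro allI impI)
      fix q e :: real assume "q < 1" "0 < e"
      then obtain d where d: "d > 0" and *:
          "\<And>s t z. s \<in> I \<Longrightarrow> t \<in> I \<Longrightarrow> s \<le> t \<Longrightarrow> \<bar>s - s\<^sub>0\<bar> < d \<Longrightarrow> \<bar>t - t\<^sub>0\<bar> < d \<Longrightarrow>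
             cmod z \<le> q \<Longrightarrow> cmod (\<omega> s t z - \<omega> s\<^sub>0 t\<^sub>0 z) < e"
        using r unfolding loc_unif_continuous_at_def by meson
      have "dist (?w x z) (\<omega> s\<^sub>0 t\<^sub>0 z) < e"
        if "x \<in> ordered_pairs I" "dist x (s\<^sub>0, t\<^sub>0) < d" "z \<in> cball 0 q" for x z
        using that *[of "fst x" "snd x" z] dist_fst_le[of x "(s\<^sub>0, t\<^sub>0)"] dist_snd_le[of x "(s\<^sub>0, t\<^sub>0)"]
        by (auto simp: ordered_pairs_def dist_norm)
      then show "\<exists>d>0. \<forall>x\<in>ordered_pairs I. x \<noteq> (s\<^sub>0, t\<^sub>0) \<and> dist x (s\<^sub>0, t\<^sub>0) < d \<longrightarrow>
          (\<forall>z\<in>cball 0 q. dist (?w x z) (\<omega> s\<^sub>0 t\<^sub>0 z) < e)"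
        using d by blast
    qed
  qed
  finally show ?thesis .
qed

lemma jointly_continuous_iff:
  "jointly_continuous I \<omega> \<longleftrightarrow> (\<forall>s\<in>I. \<forall>t\<in>I. s \<le> t \<longrightarrow> loc_unif_continuous_at I \<omega> s t)"
  unfolding jointly_continuous_def continuous_map_eq_topcontinuous_at
  using topcontinuous_at_iff by (auto simp: ordered_pairs_def)

lemma jointly_continuous_on_diagonal_iff:
  "jointly_continuous_on_diagonal I \<omega> \<longleftrightarrow> (\<forall>t\<in>I. loc_unif_continuous_at I \<omega> t t)"
  unfolding jointly_continuous_on_diagonal_def using topcontinuous_at_iff by auto

lemma hyperbolically_bounded_iff:
  assumes "I \<noteq> {}"
  shows "hyperbolically_bounded I \<omega> \<longleftrightarrow>
    (\<exists>\<rho><1. \<forall>s\<in>I. \<forall>t\<in>I. s \<le> t \<longrightarrow> cmod (\<omega> s t 0) \<le> \<rho>)"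
proof
  let ?g = "\<lambda>(s, t). cmod (\<omega> s t 0)"
  have "bdd_above (?g ` ordered_pairs I)"
    using self_map_norm_less[OF self_map, of _ _ 0]
    by (intro bdd_aboveI[of _ 1]) (auto simp: ordered_pairs_def less_imp_le)
  then have "?g x \<le> Sup (?g ` ordered_pairs I)" if "x \<in> ordered_pairs I" for x
    using that by (rule cSUP_upper2) auto
  then show "\<exists>\<rho><1. \<forall>s\<in>I. \<forall>t\<in>I. s \<le> t \<longrightarrow> cmod (\<omega> s t 0) \<le> \<rho>" if "hyperbolically_bounded I \<omega>"
    using that unfolding hyperbolically_bounded_def
    by (intro exI[of _ "Sup (?g ` ordered_pairs I)"]) (force simp: ordered_pairs_def)
next
  assume "\<exists>\<rho><1. \<forall>s\<in>I. \<forall>t\<in>I. s \<le> t \<longrightarrow> cmod (\<omega> s t 0) \<le> \<rho>"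
  then obtain \<rho> where \<rho>: "\<rho> < 1" "\<And>s t. s \<in> I \<Longrightarrow> t \<in> I \<Longrightarrow> s \<le> t \<Longrightarrow> cmod (\<omega> s t 0) \<le> \<rho>"
    by blast
  have "(SUP (s, t)\<in>ordered_pairs I. cmod (\<omega> s t 0)) \<le> \<rho>"
    using assms \<rho>(2) by (intro cSUP_least) (auto simp: ordered_pairs_def)
  then show "hyperbolically_bounded I \<omega>"
    using \<rho>(1) by (simp add: hyperbolically_bounded_def)
qed

lemma hyperbolically_bounded_imp_uniform_growth:
  assumes "hyperbolically_bounded I \<omega>" "I \<noteq> {}" "0 \<le> r" "r < 1"
  obtains R where "r \<le> R" "R < 1"
    "\<And>s t z. s \<in> I \<Longrightarrow> t \<in> I \<Longrightarrow> s \<le> t \<Longrightarrow> cmod z \<le> r \<Longrightarrow> cmod (\<omega> s t z) \<le> R"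
proof -
  obtain \<rho> where \<rho>: "\<rho> < 1" "\<And>s t. s \<in> I \<Longrightarrow> t \<in> I \<Longrightarrow> s \<le> t \<Longrightarrow> cmod (\<omega> s t 0) \<le> \<rho>"
    using assms hyperbolically_bounded_iff by blast
  show thesis
    by (rule self_maps_uniform_growth[OF assms(3,4) \<rho>(1)]) (use \<rho>(2) self_map in \<open>blast intro: that\<close>)
qed

subsection \<open>Moving the initial and the final time\<close>

text \<open>
  The outer factor \<open>\<omega> u t\<close> is close to the identity on a disk that contains the value of the inner
  one.
\<close>

lemma change_of_final_time:
  assumes "s \<in> I" "u \<in> I" "t \<in> I" "s \<le> u" "u \<le> t" "cmod z < 1" "cmod (\<omega> s u z) \<le> R"
    and "\<And>w. cmod w \<le> R \<Longrightarrow> cmod (\<omega> u t w - w) < e"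
  shows "cmod (\<omega> s t z - \<omega> s u z) < e"
  using assms cocycle by metis

text \<open>
  The inner factor moves \<open>z\<close> only a little inside the disk of radius \<open>R\<close>, and the outer one is Lipschitz
  there with constant \<open>1 / (1 - R)\<close>.
\<close>

lemma change_of_initial_time:
  assumes "s \<in> I" "u \<in> I" "t \<in> I" "s \<le> u" "u \<le> t" "R < 1" "cmod z \<le> R" "cmod (\<omega> s u z) \<le> R"
    and "cmod (\<omega> s u z - z) < e * (1 - R)"
  shows "cmod (\<omega> s t z - \<omega> u t z) < e"
proof -
  have "cmod (\<omega> u t (\<omega> s u z) - \<omega> u t z) \<le> cmod (\<omega> s u z - z) / (1 - R)"
    using assms by (intro self_map_lipschitz self_map) auto
  also have "\<dots> < e" using assms by (simp add: pos_divide_less_eq)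
  finally show ?thesis using assms by (simp add: cocycle)
qed

text \<open>
  Passing from \<open>\<omega> s t\<close> through \<open>\<omega> s t\<^sub>0\<close> to \<open>\<omega> s\<^sub>0 t\<^sub>0\<close>, each step changes one time and composes with a
  factor whose two times are both near \<open>t\<^sub>0\<close> or both near \<open>s\<^sub>0\<close>.
\<close>

lemma diagonal_imp_everywhere:
  assumes hb: "hyperbolically_bounded I \<omega>"
    and diag: "\<And>t. t \<in> I \<Longrightarrow> loc_unif_continuous_at I \<omega> t t"
    and st: "s\<^sub>0 \<in> I" "t\<^sub>0 \<in> I" "s\<^sub>0 \<le> t\<^sub>0"
  shows "loc_unif_continuous_at I \<omega> s\<^sub>0 t\<^sub>0"
proof (cases "s\<^sub>0 = t\<^sub>0")
  case True
  then show ?thesis using diag st by simp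
next
  case False
  show ?thesis
    unfolding loc_unif_continuous_at_def
  proof (intro allI impI)
    fix r e :: real assume "r < 1" and e: "0 < e"
    obtain R where R: "max 0 r \<le> R" "R < 1"
        "\<And>s t z. s \<in> I \<Longrightarrow> t \<in> I \<Longrightarrow> s \<le> t \<Longrightarrow> cmod z \<le> max 0 r \<Longrightarrow> cmod (\<omega> s t z) \<le> R"
      by (rule hyperbolically_bounded_imp_uniform_growth[OF hb, of "max 0 r"])
        (use st \<open>r < 1\<close> in auto)
    have e1: "0 < e / 2 * (1 - R)" using e R(2) by simp
    obtain d1 where d1: "d1 > 0" "\<And>s t z. s \<in> I \<Longrightarrow> t \<in> I \<Longrightarrow> s \<le> t \<Longrightarrow> \<bar>s - s\<^sub>0\<bar> < d1 \<Longrightarrow>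
        \<bar>t - s\<^sub>0\<bar> < d1 \<Longrightarrow> cmod z \<le> R \<Longrightarrow> cmod (\<omega> s t z - z) < e / 2 * (1 - R)"
      by (rule continuous_at_diagonal_near_identity[OF st(1) diag[OF st(1)] R(2) e1]) blast
    obtain d2 where d2: "d2 > 0" "\<And>s t z. s \<in> I \<Longrightarrow> t \<in> I \<Longrightarrow> s \<le> t \<Longrightarrow> \<bar>s - t\<^sub>0\<bar> < d2 \<Longrightarrow>
        \<bar>t - t\<^sub>0\<bar> < d2 \<Longrightarrow> cmod z \<le> R \<Longrightarrow> cmod (\<omega> s t z - z) < e / 2"
      by (rule continuous_at_diagonal_near_identity[OF st(2) diag[OF st(2)] R(2) half_gt_zero[OF e]]) blast
    \<comment> \<open>the bound \<open>t\<^sub>0 - s\<^sub>0\<close> ensures \<open>s \<le> t\<^sub>0\<close>, so that \<open>\<omega> s t\<^sub>0\<close> belongs to the family\<close>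
    define d where "d = min (min d1 d2) (t\<^sub>0 - s\<^sub>0)"
    have "cmod (\<omega> s t z - \<omega> s\<^sub>0 t\<^sub>0 z) < e"
      if s: "s \<in> I" and t: "t \<in> I" and "s \<le> t" "\<bar>s - s\<^sub>0\<bar> < d" "\<bar>t - t\<^sub>0\<bar> < d" and z: "cmod z \<le> r"
      for s t z
    proof -
      have *: "s \<le> t\<^sub>0" "\<bar>s - s\<^sub>0\<bar> < d1" "\<bar>t - t\<^sub>0\<bar> < d2" using that by (auto simp: d_def)
      have z': "cmod z < 1" "cmod z \<le> max 0 r" "cmod z \<le> R" using z R \<open>r < 1\<close> by auto
      have "cmod (\<omega> s t z - \<omega> s t\<^sub>0 z) < e / 2"
      proof (cases "t\<^sub>0 \<le> t")
        case True
        then show ?thesis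
          using * s t st d2 z' R(3) by (intro change_of_final_time[where R = R]) auto
      next
        case False
        then have "cmod (\<omega> s t\<^sub>0 z - \<omega> s t z) < e / 2"
          using * s t st d2 z' R(3) \<open>s \<le> t\<close> by (intro change_of_final_time[where R = R]) auto
        then show ?thesis by (simp add: norm_minus_commute)
      qed
      moreover have "cmod (\<omega> s t\<^sub>0 z - \<omega> s\<^sub>0 t\<^sub>0 z) < e / 2"
      proof (cases "s \<le> s\<^sub>0")
        case True
        then show ?thesis
          using * s t st d1 z' R(2,3) by (intro change_of_initial_time[where R = R]) auto
      next
        case False
        then have "cmod (\<omega> s\<^sub>0 t\<^sub>0 z - \<omega> s t\<^sub>0 z) < e / 2"
          using * s t st d1 z' R(2,3) by (intro change_of_initial_time[where R = R]) auto
        then show ?thesis by (simp add: norm_minus_commute)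
      qed
      ultimately show ?thesis
        using norm_diff_triangle_less by fastforce
    qed
    moreover have "d > 0" using d1(1) d2(1) st False by (simp add: d_def)
    ultimately show "\<exists>d>0. \<forall>s\<in>I. \<forall>t\<in>I. s \<le> t \<longrightarrow> \<bar>s - s\<^sub>0\<bar> < d \<longrightarrow> \<bar>t - t\<^sub>0\<bar> < d \<longrightarrow>
          (\<forall>z. cmod z \<le> r \<longrightarrow> cmod (\<omega> s t z - \<omega> s\<^sub>0 t\<^sub>0 z) < e)"
      by blast
  qed
qed

lemma diagonal_imp_limits:
  assumes c: "c \<in> I" and diag: "loc_unif_continuous_at I \<omega> c c"
  shows "((\<lambda>(s, t). \<omega> s t 0) \<longlongrightarrow> 0) (shrinking_to I c)"
    and "((\<lambda>(s, t). deriv (\<omega> s t) 0) \<longlongrightarrow> 1) (shrinking_to I c)"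
proof -
  have ex: "\<exists>d>0. \<forall>s\<in>I. \<forall>t\<in>I. s \<le> c \<longrightarrow> c \<le> t \<longrightarrow> s < t \<longrightarrow> t - s < d \<longrightarrow>
      (\<forall>z. cmod z \<le> 1/2 \<longrightarrow> cmod (\<omega> s t z - z) < e)" if e: "0 < e" for e
  proof -
    have half: "1/2 < (1 :: real)" by simp
    obtain d where "d > 0" "\<And>s t z. s \<in> I \<Longrightarrow> t \<in> I \<Longrightarrow> s \<le> t \<Longrightarrow> \<bar>s - c\<bar> < d \<Longrightarrow>
        \<bar>t - c\<bar> < d \<Longrightarrow> cmod z \<le> 1/2 \<Longrightarrow> cmod (\<omega> s t z - z) < e"
      by (rule continuous_at_diagonal_near_identity[OF c diag half e]) blast
    then show ?thesis by (intro exI[of _ d]) auto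
  qed
  show "((\<lambda>(s, t). \<omega> s t 0) \<longlongrightarrow> 0) (shrinking_to I c)"
  proof (rule tendstoI)
    fix e :: real assume "0 < e"
    from ex[OF this] obtain d where "d > 0" "\<And>s t z. s \<in> I \<Longrightarrow> t \<in> I \<Longrightarrow> s \<le> c \<Longrightarrow> c \<le> t \<Longrightarrow>
        s < t \<Longrightarrow> t - s < d \<Longrightarrow> cmod z \<le> 1/2 \<Longrightarrow> cmod (\<omega> s t z - z) < e" by blast
    from this(1) this(2)[where z = 0]
    show "\<forall>\<^sub>F x in shrinking_to I c. dist (case x of (s, t) \<Rightarrow> \<omega> s t 0) 0 < e"
      unfolding eventually_shrinking_to by (intro exI[of _ d]) auto
  qed
  show "((\<lambda>(s, t). deriv (\<omega> s t) 0) \<longlongrightarrow> 1) (shrinking_to I c)"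
  proof (rule tendstoI)
    fix e :: real assume e: "0 < e"
    then obtain d where d: "d > 0" "\<And>s t z. s \<in> I \<Longrightarrow> t \<in> I \<Longrightarrow> s \<le> c \<Longrightarrow> c \<le> t \<Longrightarrow>
        s < t \<Longrightarrow> t - s < d \<Longrightarrow> cmod z \<le> 1/2 \<Longrightarrow> cmod (\<omega> s t z - z) < e / 4"
      using ex[of "e / 4"] by auto
    have "dist (deriv (\<omega> s t) 0) 1 < e"
      if "s \<in> I" "t \<in> I" "s \<le> c" "c \<le> t" "s < t" "t - s < d" for s t
    proof -
      have "cmod (deriv (\<omega> s t) 0 - 1) \<le> 2 * (e / 4)"
        using d(2)[OF that] that
        by (intro deriv_near_one self_map_holomorphic self_map) (auto simp: less_imp_le)
      then show ?thesis using e by (simp add: dist_norm)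
    qed
    then show "\<forall>\<^sub>F x in shrinking_to I c. dist (case x of (s, t) \<Rightarrow> deriv (\<omega> s t) 0) 1 < e"
      unfolding eventually_shrinking_to using d(1) by auto
  qed
qed

text \<open>
  The hypotheses control \<open>\<omega> s t\<close> only for \<open>s \<le> c \<le> t\<close>. If both times lie to the right of \<open>c\<close>, then
  \<open>\<omega> s t\<close> is the outer factor of \<open>\<omega> c t\<close>, whose inner factor \<open>\<omega> c s\<close> is near the identity. If both
  lie to the left, it is the inner factor of \<open>\<omega> s c\<close>, whose outer factor \<open>\<omega> t c\<close> is near the identity
  on the compact set that contains its values.
\<close>

lemma limits_imp_diagonal:
  assumes hb: "hyperbolically_bounded I \<omega>" and c: "c \<in> I"
    and lim0: "((\<lambda>(s, t). \<omega> s t 0) \<longlongrightarrow> 0) (shrinking_to I c)"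
    and lim1: "((\<lambda>(s, t). deriv (\<omega> s t) 0) \<longlongrightarrow> 1) (shrinking_to I c)"
  shows "loc_unif_continuous_at I \<omega> c c"
  unfolding loc_unif_continuous_at_def
proof (intro allI impI)
  fix r e :: real assume "r < 1" and e: "0 < e"
  obtain R where R: "max 0 r \<le> R" "R < 1"
      "\<And>s t z. s \<in> I \<Longrightarrow> t \<in> I \<Longrightarrow> s \<le> t \<Longrightarrow> cmod z \<le> max 0 r \<Longrightarrow> cmod (\<omega> s t z) \<le> R"
    by (rule hyperbolically_bounded_imp_uniform_growth[OF hb, of "max 0 r"])
      (use c \<open>r < 1\<close> in auto)
  \<comment> \<open>the factor \<open>1 - R\<close> compensates for the Lipschitz constant of the outer map\<close>
  define e' where "e' = e / 2 * (1 - R)"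
  have e': "0 < e'" "e' \<le> e / 2" using e R by (auto simp: e'_def field_simps)
  obtain \<delta> where \<delta>: "0 < \<delta>" "\<And>f z. f \<in> analytic_self_maps \<Longrightarrow> cmod (f 0) < \<delta> \<Longrightarrow>
      cmod (deriv f 0 - 1) < \<delta> \<Longrightarrow> cmod z \<le> R \<Longrightarrow> cmod (f z - z) < e'"
    by (rule self_maps_near_identity[OF R(2) e'(1)]) blast
  have "eventually (\<lambda>(s, t). cmod (\<omega> s t 0) < \<delta> \<and> cmod (deriv (\<omega> s t) 0 - 1) < \<delta>) (shrinking_to I c)"
    using tendstoD[OF lim0 \<delta>(1)] tendstoD[OF lim1 \<delta>(1)]
    by eventually_elim (auto simp: dist_norm)
  then obtain d where d: "d > 0" and
      *: "\<And>s t. s \<in> I \<Longrightarrow> t \<in> I \<Longrightarrow> s \<le> c \<Longrightarrow> c \<le> t \<Longrightarrow> s < t \<Longrightarrow> t - s < d \<Longrightarrow>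
         cmod (\<omega> s t 0) < \<delta> \<and> cmod (deriv (\<omega> s t) 0 - 1) < \<delta>"
    unfolding eventually_shrinking_to by auto
  have straddle: "cmod (\<omega> s t z - z) < e'"
    if "s \<in> I" "t \<in> I" "s \<le> c" "c \<le> t" "t - s < d" "cmod z \<le> R" for s t z
  proof (cases "s < t")
    case True
    then show ?thesis using \<delta>(2)[OF self_map] * that by auto
  next
    case False
    \<comment> \<open>the limit excludes \<open>s = t\<close>, where the map is exactly the identity\<close>
    then have "s = t" using that by simp
    then show ?thesis using that e' R(2) ident[of t z] by simp
  qed
  have "cmod (\<omega> s t z - \<omega> c c z) < e"
    if st: "s \<in> I" "t \<in> I" "s \<le> t" "\<bar>s - c\<bar> < d/2" "\<bar>t - c\<bar> < d/2" and z: "cmod z \<le> r" for s t z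
  proof -
    have z': "cmod z < 1" "cmod z \<le> max 0 r" "cmod z \<le> R" using z R \<open>r < 1\<close> by auto
    consider "s \<le> c" "c \<le> t" | "c < s" | "t < c" by linarith
    then have "cmod (\<omega> s t z - z) < e"
    proof cases
      case 1
      then have "cmod (\<omega> s t z - z) < e'" using st z' by (intro straddle) linarith+
      then show ?thesis using e' e by simp
    next
      case 2
      then have "cmod (\<omega> c s z - z) < e'" "cmod (\<omega> c t z - z) < e'"
        using st z' c by (auto intro!: straddle)
      moreover from this(1) have "cmod (\<omega> c t z - \<omega> s t z) < e / 2"
        using 2 st c z' R(2,3)
        by (intro change_of_initial_time[where R = R]) (auto simp: e'_def)
      ultimately show ?thesis
        using e' norm_triangle_ineq4[of "\<omega> c t z - z" "\<omega> c t z - \<omega> s t z"] by simp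
    next
      case 3
      then have "cmod (\<omega> s c z - z) < e'"
        using st z' c by (auto intro!: straddle)
      moreover have "cmod (\<omega> s c z - \<omega> s t z) < e'"
        using 3 st c z' R(3)
        by (intro change_of_final_time[where R = R]) (auto intro!: straddle)
      ultimately show ?thesis
        using e' norm_triangle_ineq4[of "\<omega> s c z - z" "\<omega> s c z - \<omega> s t z"] by simp
    qed
    then show ?thesis using ident[OF c z'(1)] by simp
  qed
  then show "\<exists>d>0. \<forall>s\<in>I. \<forall>t\<in>I. s \<le> t \<longrightarrow> \<bar>s - c\<bar> < d \<longrightarrow> \<bar>t - c\<bar> < d \<longrightarrow>
      (\<forall>z. cmod z \<le> r \<longrightarrow> cmod (\<omega> s t z - \<omega> c c z) < e)"
    using d by (intro exI[of _ "d/2"]) auto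
qed

end

text \<open>
  Boundedness over two adjacent time intervals gives boundedness over their union: for times in
  different intervals, the outer factor is applied to a point of a fixed smaller disk. Near each
  point of the diagonal, boundedness holds because \<open>\<omega> s t\<close> is close to the identity there. Compactness
  of the time interval, in the form of Bolzano's bisection principle, joins the pieces.
\<close>

lemma diagonal_imp_hyperbolically_bounded:
  assumes "a \<le> b" "evolution_family {a..b} \<omega>"
    and diag: "\<And>t. t \<in> {a..b} \<Longrightarrow> loc_unif_continuous_at {a..b} \<omega> t t"
  shows "hyperbolically_bounded {a..b} \<omega>"
proof -
  interpret evolution "{a..b}" \<omega> by unfold_locales (rule assms)
  define bounded_on where "bounded_on u v \<longleftrightarrow>
    (\<exists>\<rho><1. \<forall>s\<in>{a..b}. \<forall>t\<in>{a..b}. u \<le> s \<longrightarrow> s \<le> t \<longrightarrow> t \<le> v \<longrightarrow> cmod (\<omega> s t 0) \<le> \<rho>)" for u v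
  have "bounded_on a b"
    using assms(1)
  proof (induction rule: Bolzano)
    case (trans u m v)
    obtain \<rho>1 where left: "\<rho>1 < 1" "\<And>s t. s \<in> {a..b} \<Longrightarrow> t \<in> {a..b} \<Longrightarrow> u \<le> s \<Longrightarrow> s \<le> t \<Longrightarrow> t \<le> m \<Longrightarrow>
        cmod (\<omega> s t 0) \<le> \<rho>1" using trans(1) unfolding bounded_on_def by blast
    obtain \<rho>2 where right: "\<rho>2 < 1" "\<And>s t. s \<in> {a..b} \<Longrightarrow> t \<in> {a..b} \<Longrightarrow> m \<le> s \<Longrightarrow> s \<le> t \<Longrightarrow> t \<le> v \<Longrightarrow>
        cmod (\<omega> s t 0) \<le> \<rho>2" using trans(2) unfolding bounded_on_def by blast
    obtain R where R: "max 0 \<rho>1 \<le> R" "R < 1" "\<And>f z. f \<in> analytic_self_maps \<Longrightarrow> cmod (f 0) \<le> \<rho>2 \<Longrightarrow>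
        cmod z \<le> max 0 \<rho>1 \<Longrightarrow> cmod (f z) \<le> R"
      by (rule self_maps_uniform_growth[of "max 0 \<rho>1" \<rho>2]) (use left(1) right(1) in auto)
    have "cmod (\<omega> s t 0) \<le> max R \<rho>2"
      if st: "s \<in> {a..b}" "t \<in> {a..b}" "u \<le> s" "s \<le> t" "t \<le> v" for s t
    proof -
      consider "t \<le> m" | "m \<le> s" | "s \<le> m" "m \<le> t" by linarith
      then show ?thesis
      proof cases
        case 1 then show ?thesis using left(2)[of s t] R(1) st by auto
      next
        case 2 then show ?thesis using right(2)[of s t] st by auto
      next
        case 3
        then have m: "m \<in> {a..b}" using st by auto
        have "cmod (\<omega> m t (\<omega> s m 0)) \<le> R"
          using 3 st m left(2)[of s m] right(2)[of m t] by (intro R(3) self_map) auto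
        then show ?thesis using cocycle[of s m t 0] 3 st m by simp
      qed
    qed
    then show ?case unfolding bounded_on_def using R(2) right(1) by (intro exI[of _ "max R \<rho>2"]) auto
  next
    case (local x)
    then have x: "x \<in> {a..b}" by simp
    obtain d where d: "d > 0" "\<And>s t z. s \<in> {a..b} \<Longrightarrow> t \<in> {a..b} \<Longrightarrow> s \<le> t \<Longrightarrow> \<bar>s - x\<bar> < d \<Longrightarrow>
        \<bar>t - x\<bar> < d \<Longrightarrow> cmod z \<le> 0 \<Longrightarrow> cmod (\<omega> s t z - z) < 1/2"
      by (rule continuous_at_diagonal_near_identity[OF x diag[OF x], of 0 "1/2"]) auto
    have "bounded_on u v" if "u \<le> x" "x \<le> v" "v - u < d" for u v
      unfolding bounded_on_def using that d(2)[where z = 0]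
      by (intro exI[of _ "1/2"]) (auto simp: less_imp_le)
    with d(1) show ?case by blast
  qed
  then show ?thesis
    using assms(1) unfolding bounded_on_def by (subst hyperbolically_bounded_iff) auto
qed

theorem theorem1p9:
  fixes a b :: real
    and \<omega> :: "real \<Rightarrow> real \<Rightarrow> complex \<Rightarrow> complex"
  assumes "a < b"
    and "evolution_family {a..b} \<omega>"
  shows "(jointly_continuous {a..b} \<omega> \<longleftrightarrow> jointly_continuous_on_diagonal {a..b} \<omega>) \<and>
    (jointly_continuous_on_diagonal {a..b} \<omega> \<longleftrightarrow>
      hyperbolically_bounded {a..b} \<omega> \<and>
      (\<forall>c\<in>{a..b}.
        ((\<lambda>(s, t). \<omega> s t 0) \<longlongrightarrow> 0) (shrinking_to {a..b} c) \<and>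
        ((\<lambda>(s, t). deriv (\<omega> s t) 0) \<longlongrightarrow> 1) (shrinking_to {a..b} c)))"
proof -
  interpret evolution "{a..b}" \<omega> by unfold_locales (rule assms)
  have bounded: "hyperbolically_bounded {a..b} \<omega>"
    if "\<And>t. t \<in> {a..b} \<Longrightarrow> loc_unif_continuous_at {a..b} \<omega> t t"
    using that assms by (intro diagonal_imp_hyperbolically_bounded) auto
  show ?thesis
    unfolding jointly_continuous_iff jointly_continuous_on_diagonal_iff
    using bounded diagonal_imp_everywhere diagonal_imp_limits limits_imp_diagonal
    by (intro conjI iffI ballI impI) blast+
qed

end
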